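(* For each $n\ge 2$ let $\mathbf{p}=\{p(i,j)\}_{1\le i\neq j\le n}$ be a vector of edge probabilities and let $U_n$ be an integer with $2\le U_n\le n$. Define $t_n$ by $$\log\left(\frac{1}{t_n}\right) := \inf_{S\subset\{1,\dots,n\}:\ \#S=U_n}\ \binom{\#S}{2}^{-1}\sum_{\{i,j\}\subset S,\ i\ne j}\log\left(\frac{1}{p(i,j)}\right)$$ and $$f_n := \frac{U_n-1}{2}\log\left(\frac{1}{t_n}\right)-\log n .$$ Then, for all $n\ge 2$, $$\mathbb{P}_{\mathbf{p}}\left(\omega(G(n,\mathbf{p}))\le U_n\right)\ \ge\ 1-\exp\left(-f_nU_n\right).$$
   Context: $\mathbf{p}=\{p(i,j)\}$ is a symmetric vector of probabilities in $[0,1]$, with the convention $\log(1/0)=+\infty$ (and $\exp(-\infty)=0$). $G(n,\mathbf{p})$ is the inhomogeneous Erdős–Rényi random graph on vertex set $\{1,\dots,n\}$: each edge $\{i,j\}$ is present with probability $p(i,j)$, independently over unordered pairs; $\mathbb{P}_{\mathbf{p}}$ is the corresponding probability measure. $\omega(G)$ denotes the number of vertices in a largest clique (complete induced subgraph) of $G$. $\#S$ is the cardinality of $S$. The sum in the definition of $t_n$ is over unordered pairs of distinct elements of $S$. *)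

theory Defs
  imports "HOL-Probability.Probability" "HOL-Library.Ramsey"
begin

text \<open>The logarithm on \<open>[0, \<infinity>]\<close> and the exponential on \<open>[-\<infinity>, \<infinity>]\<close>. In \<^typ>\<open>ereal\<close> we have
  \<open>1 / 0 = \<infinity>\<close>, so \<open>elog (1 / 0) = \<infinity>\<close>; values of \<open>elog\<close> at negative arguments are irrelevant.\<close>

definition elog :: "ereal \<Rightarrow> ereal" where
  "elog x = (case x of ereal r \<Rightarrow> if r \<le> 0 then -\<infinity> else ereal (ln r) | PInfty \<Rightarrow> \<infinity> | MInfty \<Rightarrow> -\<infinity>)"

definition eexp :: "ereal \<Rightarrow> ereal" where
  "eexp x = (case x of ereal r \<Rightarrow> ereal (exp r) | PInfty \<Rightarrow> \<infinity> | MInfty \<Rightarrow> 0)"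

text \<open>Unordered pairs of distinct elements of \<open>S\<close> are the members of \<^term>\<open>nsets S 2\<close>. The value of a
  symmetric \<open>p\<close> on such a pair is read off from either ordering of it.\<close>

definition edge_prob :: "(nat \<Rightarrow> nat \<Rightarrow> real) \<Rightarrow> nat set \<Rightarrow> real" where
  "edge_prob p e = p (Min e) (Max e)"

lemma edge_prob_doubleton:
  assumes "i \<noteq> j" "p i j = p j i"
  shows "edge_prob p {i, j} = p i j"
  using assms by (cases "i < j") (auto simp: edge_prob_def min_def max_def)

text \<open>The law of the (random) edge set of the graph on the vertex set \<open>{1..n}\<close>.\<close>

definition inhom_random_graph :: "nat \<Rightarrow> (nat \<Rightarrow> nat \<Rightarrow> real) \<Rightarrow> nat set set pmf" where
  "inhom_random_graph n p =
     map_pmf (\<lambda>present. {e \<in> nsets {1..n} 2. present e})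
       (Pi_pmf (nsets {1..n} 2) False (\<lambda>e. bernoulli_pmf (edge_prob p e)))"

definition clique_number :: "nat set \<Rightarrow> nat set set \<Rightarrow> nat" where
  "clique_number V E = Max {card R | R. R \<subseteq> V \<and> clique R E}"

definition min_avg_log :: "nat \<Rightarrow> (nat \<Rightarrow> nat \<Rightarrow> real) \<Rightarrow> nat \<Rightarrow> ereal" where
  "min_avg_log n p u =
     (INF S\<in>{S. S \<subseteq> {1..n} \<and> card S = u}.
        ereal (inverse (real (card S choose 2))) *
        (\<Sum>e\<in>nsets S 2. elog (1 / ereal (edge_prob p e))))"

definition t_val :: "nat \<Rightarrow> (nat \<Rightarrow> nat \<Rightarrow> real) \<Rightarrow> nat \<Rightarrow> real" where
  "t_val n p u = (THE t. 0 \<le> t \<and> t \<le> 1 \<and> elog (1 / ereal t) = min_avg_log n p u)"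

definition f_val :: "nat \<Rightarrow> (nat \<Rightarrow> nat \<Rightarrow> real) \<Rightarrow> nat \<Rightarrow> ereal" where
  "f_val n p u = ereal ((real u - 1) / 2) * elog (1 / ereal (t_val n p u)) - ereal (ln (real n))"

lemma elog_recip_zero: "elog (1 / ereal 0) = \<infinity>"
  by (simp add: elog_def divide_ereal_def)

lemma elog_recip_pos: "0 < t \<Longrightarrow> elog (1 / ereal t) = ereal (- ln t)"
  by (simp add: elog_def one_ereal_def ln_div)

lemma elog_recip_nonneg: "0 \<le> t \<Longrightarrow> t \<le> 1 \<Longrightarrow> 0 \<le> elog (1 / ereal t)"
  by (cases "t = 0") (simp_all add: elog_recip_zero elog_recip_pos)

lemma ex1_elog_recip:
  assumes "0 \<le> x"
  shows "\<exists>!t. 0 \<le> t \<and> t \<le> 1 \<and> elog (1 / ereal t) = x"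
proof (cases x)
  case (real r)
  show ?thesis
  proof (rule ex1I[of _ "exp (- r)"])
    show "0 \<le> exp (- r) \<and> exp (- r) \<le> 1 \<and> elog (1 / ereal (exp (- r))) = x"
      using assms real by (simp add: elog_recip_pos)
    fix t assume t: "0 \<le> t \<and> t \<le> 1 \<and> elog (1 / ereal t) = x"
    then have "t \<noteq> 0" using real elog_recip_zero by auto
    then show "t = exp (- r)" using t real by (auto simp: elog_recip_pos)
  qed
next
  case PInf
  show ?thesis
  proof (rule ex1I[of _ 0])
    fix t assume "0 \<le> t \<and> t \<le> 1 \<and> elog (1 / ereal t) = x"
    then show "t = 0" using PInf elog_recip_pos[of t] by (cases "t = 0") auto
  qed (simp only: PInf elog_recip_zero, simp)
next
  case MInf
  then show ?thesis using assms by simp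
qed

text \<open>Hence \<open>t_val\<close> is well defined for every vector of probabilities.\<close>

lemma t_val_spec:
  assumes prob: "\<And>i j. i \<in> {1..n} \<Longrightarrow> j \<in> {1..n} \<Longrightarrow> i \<noteq> j \<Longrightarrow> p i j \<in> {0..1}"
  shows "0 \<le> t_val n p u" "t_val n p u \<le> 1"
    and "elog (1 / ereal (t_val n p u)) = min_avg_log n p u"
proof -
  have edge: "edge_prob p e \<in> {0..1}" if S: "S \<subseteq> {1..n}" and e: "e \<in> nsets S 2" for S e
  proof -
    from e have fin: "finite e" and c: "card e = 2" and sub: "e \<subseteq> S" by (auto simp: nsets_def)
    then obtain i j where ij: "e = {i, j}" "i \<noteq> j" by (auto simp: card_2_iff)
    then have "Min e \<noteq> Max e" by (auto simp: min_def max_def)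
    moreover have "Min e \<in> e" "Max e \<in> e" using fin ij by (auto intro!: Min_in Max_in)
    ultimately show ?thesis using prob S sub unfolding edge_prob_def by blast
  qed
  have "0 \<le> min_avg_log n p u"
    unfolding min_avg_log_def
    by (intro INF_greatest ereal_0_le_mult sum_nonneg elog_recip_nonneg) (use edge in auto)
  from theI'[OF ex1_elog_recip[OF this]]
  show "0 \<le> t_val n p u" "t_val n p u \<le> 1"
    and "elog (1 / ereal (t_val n p u)) = min_avg_log n p u"
    unfolding t_val_def by auto
qed

end

theory Submission
  imports Defs
begin

text \<open>First moment method: a graph with clique number above \<open>u\<close> has a clique of size exactly \<open>u\<close>.
  A given \<open>u\<close>-set \<open>S\<close> is a clique with probability \<open>\<Prod>p(e)\<close>, the \<open>(u choose 2)\<close>-th power of the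
  geometric mean of the edge probabilities inside \<open>S\<close>; the largest such geometric mean is \<open>t\<close>.
  The union bound gives \<open>(n choose u) t^(u choose 2) \<le> n^u t^(u(u-1)/2)\<close>, the exponential of
  \<open>-f u\<close>.\<close>

lemma edge_prob_in_unit_interval:
  assumes "\<And>i j. i \<in> V \<Longrightarrow> j \<in> V \<Longrightarrow> i \<noteq> j \<Longrightarrow> p i j \<in> {0..1}" and "e \<in> nsets V 2"
  shows "edge_prob p e \<in> {0..1}"
proof -
  from assms(2) have fin: "finite e" and c: "card e = 2" and sub: "e \<subseteq> V"
    by (auto simp: nsets_def)
  then obtain i j where ij: "e = {i, j}" "i \<noteq> j" by (auto simp: card_2_iff)
  then have "Min e \<noteq> Max e" by (auto simp: min_def max_def)
  moreover have "Min e \<in> e" "Max e \<in> e" using fin ij by (auto intro!: Min_in Max_in)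
  ultimately show ?thesis using assms(1) sub unfolding edge_prob_def by blast
qed

text \<open>Subsets of cliques are cliques, so a maximum clique can be trimmed to exactly
  \<open>u\<close> vertices. The union bound then runs over sets of a single size.\<close>

lemma clique_of_card_if_clique_number_gt:
  assumes "finite V" and "u < clique_number V E"
  obtains S where "S \<subseteq> V" "card S = u" "nsets S 2 \<subseteq> E"
proof -
  let ?C = "{card R | R. R \<subseteq> V \<and> clique R E}"
  have "finite ?C" using assms(1) by simp
  \<comment> \<open>The empty clique makes \<open>?C\<close> nonempty, so its maximum is attained by
    an actual clique.\<close>
  moreover have "card {} \<in> ?C" by (rule CollectI, rule exI[of _ "{}"]) (simp add: clique_def)
  ultimately have "Max ?C \<in> ?C" by (intro Max_in) auto
  then obtain R where R: "R \<subseteq> V" "clique R E" "u < card R"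
    using assms(2) unfolding clique_number_def by force
  then obtain S where S: "S \<subseteq> R" "card S = u"
    by (meson less_imp_le obtain_subset_with_card_n)
  have "nsets S 2 \<subseteq> E"
    using R(2) S(1) by (auto simp: nsets_def card_2_iff clique_def)
  then show thesis using R(1) S that by blast
qed

context
  fixes n :: nat and p :: "nat \<Rightarrow> nat \<Rightarrow> real"
  assumes prob: "\<And>i j. i \<in> {1..n} \<Longrightarrow> j \<in> {1..n} \<Longrightarrow> i \<noteq> j \<Longrightarrow> p i j \<in> {0..1}"
begin

text \<open>By independence: the event is a product set in the edge indicators, so its probability
  factors over the edges.\<close>

lemma prob_edges_subset_inhom_random_graph:
  assumes F: "F \<subseteq> nsets {1..n} 2"
  shows "measure_pmf.prob (inhom_random_graph n p) {E. F \<subseteq> E} = (\<Prod>e\<in>F. edge_prob p e)"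
proof -
  \<comment> \<open>Edges outside \<open>F\<close> are unconstrained and contribute a factor
    1.\<close>
  define B where "B e = (if e \<in> F then {True} else UNIV)" for e
  have fin: "finite (nsets {1..n} 2)" by (simp add: finite_imp_finite_nsets)
  have "(\<lambda>present. {e \<in> nsets {1..n} 2. present e}) -` {E. F \<subseteq> E} = Pi (nsets {1..n} 2) B"
    using F by (auto simp: B_def Pi_def)
  then have "measure_pmf.prob (inhom_random_graph n p) {E. F \<subseteq> E} =
      (\<Prod>e\<in>nsets {1..n} 2. measure_pmf.prob (bernoulli_pmf (edge_prob p e)) (B e))"
    by (simp only: inhom_random_graph_def measure_map_pmf measure_Pi_pmf_Pi[OF fin])
  also have "\<dots> = (\<Prod>e\<in>nsets {1..n} 2. if e \<in> F then edge_prob p e else 1)"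
    using edge_prob_in_unit_interval[where V = "{1..n}" and p = p, OF prob]
    by (intro prod.cong) (auto simp: B_def measure_pmf_single)
  also have "\<dots> = (\<Prod>e\<in>F. edge_prob p e)"
    using F fin by (simp add: prod.If_cases Int_absorb1)
  finally show ?thesis .
qed

text \<open>\<open>S\<close> competes in the infimum defining \<open>t_val\<close>, so the average
  of \<open>log (1/p)\<close> over its pairs is at least \<open>log (1/t)\<close>. Multiplying by
  \<open>- (u choose 2)\<close> and exponentiating gives the bound.\<close>

lemma prod_edge_prob_le_t_val_power:
  assumes S: "S \<subseteq> {1..n}" "card S = u" and u: "2 \<le> u"
  shows "(\<Prod>e\<in>nsets S 2. edge_prob p e) \<le> t_val n p u ^ (u choose 2)"
proof -
  define t where "t = t_val n p u"
  have t: "0 \<le> t" "elog (1 / ereal t) = min_avg_log n p u"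
    unfolding t_def by (rule t_val_spec, (rule prob; assumption))+
  have fin: "finite (nsets S 2)"
    using S(1) finite_subset by (blast intro: finite_imp_finite_nsets)
  have edge: "edge_prob p e \<in> {0..1}" if "e \<in> nsets S 2" for e
    using edge_prob_in_unit_interval[where V = "{1..n}" and p = p, OF prob]
      nsets_mono[OF S(1)] that by blast
  have N: "0 < u choose 2" using u by simp
  show ?thesis
  \<comment> \<open>A zero probability kills the product; otherwise all logarithms over
    \<open>S\<close> are finite and the sum is a real number.\<close>
  proof (cases "\<exists>e\<in>nsets S 2. edge_prob p e = 0")
    case True
    then have "(\<Prod>e\<in>nsets S 2. edge_prob p e) = 0" using fin by auto
    then show ?thesis using t(1) by (simp flip: t_def)
  next
    case False
    then have pos: "0 < edge_prob p e" if "e \<in> nsets S 2" for e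
      using edge[OF that] that by force
    define P where "P = (\<Prod>e\<in>nsets S 2. edge_prob p e)"
    have Ppos: "0 < P" unfolding P_def using pos by (rule prod_pos)
    have "(\<Sum>e\<in>nsets S 2. elog (1 / ereal (edge_prob p e))) =
        (\<Sum>e\<in>nsets S 2. ereal (- ln (edge_prob p e)))"
      using pos by (intro sum.cong refl elog_recip_pos)
    also have "\<dots> = ereal (- ln P)"
      unfolding P_def by (subst ln_prod) (auto simp: sum_negf fin dest!: pos)
    finally have "min_avg_log n p u \<le> ereal (inverse (real (u choose 2))) * ereal (- ln P)"
      unfolding min_avg_log_def by (intro INF_lower2[of S]) (use S in auto)
    then have le: "elog (1 / ereal t) \<le> ereal (inverse (real (u choose 2)) * - ln P)"
      by (simp only: t(2) times_ereal.simps)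
    \<comment> \<open>For \<open>t = 0\<close> the left side of \<open>le\<close> would be infinite
      while the right side is real. From here the comparison takes place in the reals.\<close>
    then have "t \<noteq> 0" using elog_recip_zero by auto
    with t(1) have tpos: "0 < t" by simp
    with le have "- ln t \<le> inverse (real (u choose 2)) * - ln P"
      by (simp only: elog_recip_pos ereal_less_eq)
    then have "ln P \<le> real (u choose 2) * ln t" using N by (simp add: field_simps)
    also have "\<dots> = ln (t ^ (u choose 2))" using tpos by (simp add: ln_realpow)
    finally show ?thesis
      using Ppos tpos by (simp add: P_def t_def)
  qed
qed

lemma prob_clique_number_gt_le:
  assumes u: "2 \<le> u"
  shows "measure_pmf.prob (inhom_random_graph n p) {E. u < clique_number {1..n} E}
    \<le> real (n choose u) * t_val n p u ^ (u choose 2)"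
proof -
  let ?M = "measure_pmf.prob (inhom_random_graph n p)"
  let ?\<S> = "{S. S \<subseteq> {1..n} \<and> card S = u}"
  have "?M {E. u < clique_number {1..n} E} \<le> ?M (\<Union>S\<in>?\<S>. {E. nsets S 2 \<subseteq> E})"
    by (intro measure_pmf.finite_measure_mono)
      (auto elim!: clique_of_card_if_clique_number_gt[OF finite_atLeastAtMost])
  also have "\<dots> \<le> (\<Sum>S\<in>?\<S>. ?M {E. nsets S 2 \<subseteq> E})"
    by (intro measure_pmf.finite_measure_subadditive_finite) auto
  also have "\<dots> \<le> (\<Sum>S\<in>?\<S>. t_val n p u ^ (u choose 2))"
  proof (intro sum_mono)
    fix S assume "S \<in> ?\<S>"
    then have "S \<subseteq> {1..n}" "card S = u" by auto
    then show "?M {E. nsets S 2 \<subseteq> E} \<le> t_val n p u ^ (u choose 2)"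
      using prod_edge_prob_le_t_val_power[OF _ _ u]
      by (simp add: prob_edges_subset_inhom_random_graph nsets_mono)
  qed
  also have "\<dots> = real (n choose u) * t_val n p u ^ (u choose 2)"
    by (simp add: n_subsets)
  finally show ?thesis .
qed

text \<open>The factor \<open>u\<close> turns \<open>(u - 1) / 2\<close> into
  \<open>u choose 2\<close> and \<open>ln n\<close> into the exponent of
  \<open>n ^ u\<close>.\<close>

lemma eexp_f_val:
  assumes u: "2 \<le> u" and n: "0 < n"
  shows "eexp (- (f_val n p u * ereal (real u))) =
    ereal (real n ^ u * t_val n p u ^ (u choose 2))"
proof (cases "t_val n p u = 0")
  case True
  \<comment> \<open>The coefficient \<open>(u - 1) / 2\<close> is positive and \<open>ln n\<close>
    is finite. Both sides of the goal then vanish: \<open>eexp\<close> sends minus infinity to 0,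
    and \<open>u choose 2\<close> is positive, so the power of 0 is 0.\<close>
  have "f_val n p u = \<infinity>"
    using u by (simp only: f_val_def True elog_recip_zero) simp
  then show ?thesis using u True by (simp add: eexp_def)
next
  case False
  then have t: "0 < t_val n p u"
    using t_val_spec(1)[where n = n and p = p and u = u, OF prob] by simp
  have choose: "real (u choose 2) = real u * (real u - 1) / 2"
    using u by (simp add: choose_two real_of_nat_div)
  have "- (f_val n p u * ereal (real u)) =
      ereal (real u * ln (real n) + real (u choose 2) * ln (t_val n p u))"
    by (simp only: f_val_def elog_recip_pos[OF t] choose) (simp add: field_simps)
  then show ?thesis
    using t n by (simp add: eexp_def exp_add exp_of_nat_mult)
qed

end

theorem proposition1:
  fixes p :: "nat \<Rightarrow> nat \<Rightarrow> nat \<Rightarrow> real" and U :: "nat \<Rightarrow> nat"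
  assumes prob: "\<And>n i j. n \<ge> 2 \<Longrightarrow> i \<in> {1..n} \<Longrightarrow> j \<in> {1..n} \<Longrightarrow> i \<noteq> j \<Longrightarrow> p n i j \<in> {0..1}"
    and sym: "\<And>n i j. n \<ge> 2 \<Longrightarrow> i \<in> {1..n} \<Longrightarrow> j \<in> {1..n} \<Longrightarrow> i \<noteq> j \<Longrightarrow> p n i j = p n j i"
    and U: "\<And>n. n \<ge> 2 \<Longrightarrow> 2 \<le> U n \<and> U n \<le> n"
  shows "\<forall>n\<ge>2. ereal (measure_pmf.prob (inhom_random_graph n (p n))
                       {E. clique_number {1..n} E \<le> U n})
                 \<ge> 1 - eexp (- (f_val n (p n) (U n) * ereal (real (U n))))"
proof (intro allI impI)
  fix n :: nat assume n: "2 \<le> n"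
  let ?M = "measure_pmf.prob (inhom_random_graph n (p n))"
  let ?t = "t_val n (p n) (U n)"
  have pr: "p n i j \<in> {0..1}" if "i \<in> {1..n}" "j \<in> {1..n}" "i \<noteq> j" for i j
    using prob n that by blast
  have u: "2 \<le> U n" "U n \<le> n" using U n by auto
  have "?M {E. U n < clique_number {1..n} E} \<le> real (n choose U n) * ?t ^ (U n choose 2)"
    using pr u(1) by (rule prob_clique_number_gt_le)
  \<comment> \<open>The binomial coefficient is relaxed to \<open>n ^ U n\<close> to reach the exact
    form of \<open>eexp_f_val\<close>.\<close>
  also have "\<dots> \<le> real n ^ U n * ?t ^ (U n choose 2)"
    using t_val_spec(1)[where n = n and p = "p n" and u = "U n", OF pr] binomial_le_pow[OF u(2)]
    by (intro mult_right_mono) (auto simp flip: of_nat_power)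
  finally have "?M {E. U n < clique_number {1..n} E} \<le> real n ^ U n * ?t ^ (U n choose 2)" .
  moreover have "?M {E. clique_number {1..n} E \<le> U n} = 1 - ?M {E. U n < clique_number {1..n} E}"
    by (subst measure_pmf.prob_compl[symmetric]) (auto intro!: arg_cong[where f = ?M])
  ultimately show "1 - eexp (- (f_val n (p n) (U n) * ereal (real (U n)))) \<le>
      ereal (?M {E. clique_number {1..n} E \<le> U n})"
    using eexp_f_val[where n = n and p = "p n", OF pr u(1)] n by (simp add: one_ereal_def)
qed

end
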